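(* Let $X$ be a finite set and $\mathcal{A}$ a collection of distinct subsets of $X$ with $|\mathcal{A}|=|X|$. Then $(\mathcal{A},X)$ is extremal if and only if there exist a digraph $D\in(K_1,\oplus,\overrightarrow{\triangleleft})$ and a graph isomorphism from $B(\mathcal{A},X)$ to $B(D)$ mapping $X$ onto the part $\{x_1,\dots,x_n\}$ and $\mathcal{A}$ onto the part $\{x'_1,\dots,x'_n\}$ (equivalently: a bijection $f:X\to V(D)$ with $\mathcal{A}=\{f^{-1}(B_1^+(v)) : v\in V(D)\}$).
   Context: A set system $(\mathcal{A},X)$ is extremal if the members of $\mathcal{A}$ are distinct and nonempty, and for every $x\in X$ either there is $A\in\mathcal{A}$ with $A-\{x\}=\emptyset$ or there are distinct $A,A'\in\mathcal{A}$ with $A-\{x\}=A'-\{x\}$. The incidence bipartite graph $B(\mathcal{A},X)$ has parts $\mathcal{A}$ and $X$, with $A\in\mathcal{A}$ adjacent to $x\in X$ iff $x\in A$. Digraphs have no loops or multiple arcs; for a vertex $u$, $B_1^+(u)$ is $u$ together with all $w$ having an arc $\overrightarrow{wu}$. For a digraph $D$ on $\{x_1,\dots,x_n\}$, $B(D)$ is the bipartite graph with parts $\{x_1,\dots,x_n\}$ and $\{x'_1,\dots,x'_n\}$ in which $x_i\sim x'_j$ iff $\overrightarrow{x_ix_j}$ is an arc or $i=j$. For digraphs $D_1,D_2$ on disjoint vertex sets, $D_1\oplus D_2$ is their disjoint union; for a digraph $D$ and a new vertex $x$, $x\overrightarrow{\triangleleft}(D)$ is obtained by adding $x$ and all arcs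 $\overrightarrow{xv}$, $v\in V(D)$. $(K_1,\oplus,\overrightarrow{\triangleleft})$ is the class of digraphs built from the one-vertex digraph $K_1$ by repeated applications of $\oplus$ and $\overrightarrow{\triangleleft}$. *)

theory Defs
  imports "Graph_Theory.Pair_Digraph" "Graph_Theory.Digraph_Isomorphism"
begin

text \<open>
  A collection of distinct subsets of \<open>X\<close> is a set of sets \<open>\<A> \<subseteq> Pow X\<close>, so the requirement
  that the members of \<open>\<A>\<close> be pairwise distinct is built into the type.
\<close>

definition extremal :: "'a set set \<Rightarrow> 'a set \<Rightarrow> bool" where
  "extremal \<A> X \<longleftrightarrow>
     {} \<notin> \<A> \<and>
     (\<forall>x\<in>X. (\<exists>A\<in>\<A>. A - {x} = {}) \<or> (\<exists>A\<in>\<A>. \<exists>A'\<in>\<A>. A \<noteq> A' \<and> A - {x} = A' - {x}))"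

text \<open>
  Undirected graphs are symmetric digraphs, as everywhere in \<open>Graph_Theory\<close>. In both bipartite
  graphs below the two parts are the \<open>Inl\<close> and the \<open>Inr\<close> summand of the vertex type; in
  \<open>bip_digraph D\<close>, the vertices \<open>Inl u\<close> and \<open>Inr u\<close> are the two copies \<open>x\<^sub>i\<close> and \<open>x'\<^sub>i\<close> of a
  vertex of \<open>D\<close>.
\<close>

definition bip_incidence :: "'a set set \<Rightarrow> 'a set \<Rightarrow> ('a + 'a set) pair_pre_digraph" where
  "bip_incidence \<A> X =
     \<lparr>pverts = Inl ` X \<union> Inr ` \<A>,
      parcs = {(Inl x, Inr A) | x A. x \<in> X \<and> A \<in> \<A> \<and> x \<in> A}
            \<union> {(Inr A, Inl x) | x A. x \<in> X \<and> A \<in> \<A> \<and> x \<in> A}\<rparr>"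

definition bip_digraph :: "'v pair_pre_digraph \<Rightarrow> ('v + 'v) pair_pre_digraph" where
  "bip_digraph D =
     \<lparr>pverts = Inl ` pverts D \<union> Inr ` pverts D,
      parcs = {(Inl u, Inr v) | u v. u \<in> pverts D \<and> v \<in> pverts D \<and> ((u, v) \<in> parcs D \<or> u = v)}
            \<union> {(Inr v, Inl u) | u v. u \<in> pverts D \<and> v \<in> pverts D \<and> ((u, v) \<in> parcs D \<or> u = v)}\<rparr>"

definition closed_in_nbhd :: "'v pair_pre_digraph \<Rightarrow> 'v \<Rightarrow> 'v set" where
  "closed_in_nbhd D u = insert u {w. (w, u) \<in> parcs D}"

definition dunion :: "'v pair_pre_digraph \<Rightarrow> 'v pair_pre_digraph \<Rightarrow> 'v pair_pre_digraph" where
  "dunion D1 D2 = \<lparr>pverts = pverts D1 \<union> pverts D2, parcs = parcs D1 \<union> parcs D2\<rparr>"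

definition add_source :: "'v \<Rightarrow> 'v pair_pre_digraph \<Rightarrow> 'v pair_pre_digraph" where
  "add_source x D =
     \<lparr>pverts = insert x (pverts D), parcs = parcs D \<union> {(x, v) | v. v \<in> pverts D}\<rparr>"

text \<open>
  The class \<open>(K\<^sub>1, \<oplus>, \<triangleleft>)\<close>. Any vertex may serve as the vertex of \<open>K\<^sub>1\<close>, which makes the class
  closed under isomorphism.
\<close>

inductive in_class :: "'v pair_pre_digraph \<Rightarrow> bool" where
  K1: "in_class \<lparr>pverts = {v}, parcs = {}\<rparr>"
| union: "in_class D1 \<Longrightarrow> in_class D2 \<Longrightarrow> pverts D1 \<inter> pverts D2 = {} \<Longrightarrow> in_class (dunion D1 D2)"
| source: "in_class D \<Longrightarrow> x \<notin> pverts D \<Longrightarrow> in_class (add_source x D)"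

lemma in_class_pair_digraph:
  assumes "in_class D"
  shows "pair_digraph D"
  using assms
proof induction
  case (K1 v)
  then show ?case by unfold_locales auto
next
  case (union D1 D2)
  interpret A: pair_digraph D1 by fact
  interpret B: pair_digraph D2 by fact
  show ?case
    by unfold_locales
      (use A.arc_fst_in_verts A.arc_snd_in_verts B.arc_fst_in_verts B.arc_snd_in_verts
        A.pair_no_loops B.pair_no_loops in \<open>fastforce simp: dunion_def\<close>)+
next
  case (source D x)
  interpret A: pair_digraph D by fact
  have eq: "{(x, v) | v. v \<in> pverts D} = Pair x ` pverts D" by auto
  show ?case
    by unfold_locales
      (use A.arc_fst_in_verts A.arc_snd_in_verts A.pair_no_loops source.hyps
        in \<open>fastforce simp: add_source_def eq\<close>)+
qed

text \<open>
  The equation for \<open>app_iso\<close> is the library's way of saying that \<open>h\<close> is onto \<open>H\<close>; it also fixes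
  \<open>iso_tail h = fst\<close> and \<open>iso_head h = snd\<close>, so \<open>h\<close> acts on arcs through its action on vertices.
\<close>

definition part_isomorphism ::
    "('a + 'b) pair_pre_digraph \<Rightarrow> ('c + 'd) pair_pre_digraph \<Rightarrow>
     ('a + 'b, ('a + 'b) \<times> ('a + 'b), 'c + 'd, ('c + 'd) \<times> ('c + 'd)) digraph_isomorphism \<Rightarrow> bool"
  where
  "part_isomorphism G H h \<longleftrightarrow>
     pre_digraph.digraph_isomorphism (with_proj G) h \<and>
     app_iso h (with_proj G) = with_proj H \<and>
     iso_verts h ` (pverts G \<inter> range Inl) = pverts H \<inter> range Inl \<and>
     iso_verts h ` (pverts G \<inter> range Inr) = pverts H \<inter> range Inr"

end

theory Submission
  imports Defs
begin

(* Adjoin the empty set to the family and join two members by an edge labelled x when they differ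
   exactly by x. Extremality says that every label in X occurs, and contracting labels one at a
   time shows that k labels need at least k + 1 members. As there are only card X + 1 members,
   every label occurs exactly once and the graph is a tree. Going up from the empty set one
   meets every label for the first time at its unique edge, so each nonempty member is the set of
   labels on the path leading to it. Hence the members are the sets of ancestors in a rooted
   forest on X, and the digraphs of the class are exactly the strict ancestor relations of such
   forests. *)

section \<open>Counting labels by contraction\<close>

text \<open>Naming an edge by its lower end orients it: the label determines the upper end, and
  going up an edge always means inserting its label.\<close>

definition cube_edge :: "'a set set \<Rightarrow> 'a \<Rightarrow> 'a set \<Rightarrow> bool" where
  "cube_edge F x C \<longleftrightarrow> C \<in> F \<and> insert x C \<in> F \<and> x \<notin> C"

lemma cube_edge_contract:
  assumes "cube_edge F y C" "y \<noteq> x"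
  shows "cube_edge ((\<lambda>C. C - {x}) ` F) y (C - {x})"
proof -
  have "insert y (C - {x}) = insert y C - {x}"
    using \<open>y \<noteq> x\<close> by auto
  then show ?thesis
    using assms unfolding cube_edge_def by auto
qed

text \<open>Induction on the labels: deleting \<open>x\<close> from every member keeps an edge for
  every other label, but merges the two ends of an \<open>x\<close>-edge, so at least one member is
  lost along with the one label.\<close>

lemma card_labels_less:
  assumes "finite L" "finite F" "F \<noteq> {}" "\<And>x. x \<in> L \<Longrightarrow> \<exists>C. cube_edge F x C"
  shows "card L < card F"
  using assms
proof (induction L arbitrary: F rule: finite_induct)
  case empty
  then show ?case by (simp add: card_gt_0_iff)
next
  case (insert x L)
  let ?F' = "(\<lambda>C. C - {x}) ` F"
  obtain C where C: "cube_edge F x C"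
    using insert.prems by blast
  have "\<exists>D. cube_edge ?F' y D" if "y \<in> L" for y
    using that insert.hyps insert.prems(3)[of y] cube_edge_contract[of F y _ x] by (metis insertCI)
  then have "card L < card ?F'"
    using insert.prems by (intro insert.IH) auto
  moreover have "\<not> inj_on (\<lambda>C. C - {x}) F"
    using C unfolding cube_edge_def inj_on_def by (metis Diff_insert_absorb insertI1 insert_Diff_if)
  then have "card ?F' < card F"
    using insert.prems(1) by (metis card_image_le eq_card_imp_inj_on le_neq_implies_less)
  ultimately show ?case
    using insert.hyps by simp
qed

section \<open>Forest orders give digraphs of the class\<close>

text \<open>A root \<open>r\<close> and its descendants form a component. If this is everything,
  \<open>r\<close> is a source over the rest; otherwise the component splits off as a disjoint
  summand. Both cases leave smaller nonempty vertex sets.\<close>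

lemma in_class_forest:
  assumes "finite X" "X \<noteq> {}"
    and "\<And>u v. u \<in> X \<Longrightarrow> v \<in> X \<Longrightarrow> R u v \<Longrightarrow> R v u \<Longrightarrow> u = v"
    and "\<And>u v w. u \<in> X \<Longrightarrow> v \<in> X \<Longrightarrow> w \<in> X \<Longrightarrow> R u v \<Longrightarrow> R v w \<Longrightarrow> R u w"
    and "\<And>u v w. u \<in> X \<Longrightarrow> v \<in> X \<Longrightarrow> w \<in> X \<Longrightarrow> R u w \<Longrightarrow> R v w \<Longrightarrow> R u v \<or> R v u"
  shows "in_class \<lparr>pverts = X, parcs = {(u, v). u \<in> X \<and> v \<in> X \<and> u \<noteq> v \<and> R u v}\<rparr>"
    (is "in_class (?D X)")
  using assms
proof (induction X rule: finite_psubset_induct)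
  case (psubset X)
  note antisym = psubset.prems(2) and trans = psubset.prems(3) and forest = psubset.prems(4)
  have IH: "in_class (?D Y)" if "Y \<subset> X" "Y \<noteq> {}" for Y
  proof (rule psubset.IH[OF that])
    have sub: "u \<in> X" if "u \<in> Y" for u
      using that \<open>Y \<subset> X\<close> by blast
    show "u = v" if "u \<in> Y" "v \<in> Y" "R u v" "R v u" for u v
      using antisym that sub by metis
    show "R u w" if "u \<in> Y" "v \<in> Y" "w \<in> Y" "R u v" "R v w" for u v w
      using trans[of u v w] that sub by simp
    show "R u v \<or> R v u" if "u \<in> Y" "v \<in> Y" "w \<in> Y" "R u w" "R v w" for u v w
      using forest[of u v w] that sub by simp
  qed
  \<comment> \<open>The strict part of \<open>R\<close> is finite, transitive and irreflexive, hence
    well-founded; a minimal element serves as the root.\<close>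
  define S where "S = {(u, v). u \<in> X \<and> v \<in> X \<and> u \<noteq> v \<and> R u v}"
  have "trans S"
    unfolding S_def trans_def using antisym trans by blast
  moreover have "irrefl S"
    unfolding S_def irrefl_def by blast
  moreover have "finite S"
    by (rule finite_subset[of _ "X \<times> X"]) (use psubset.hyps in \<open>auto simp: S_def\<close>)
  ultimately have "wf S"
    by (intro finite_acyclic_wf) (auto simp: acyclic_irrefl)
  then obtain r where r: "r \<in> X" "\<And>y. (y, r) \<in> S \<Longrightarrow> y \<notin> X"
    using psubset.prems(1) unfolding wf_eq_minimal by blast
  have min: "y = r" if "y \<in> X" "R y r" for y
    using r that unfolding S_def by blast
  \<comment> \<open>\<open>r\<close> is put in explicitly because \<open>R\<close> is not assumed
    reflexive.\<close>
  define U where "U = {v \<in> X. v = r \<or> R r v}"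
  show ?case
  proof (cases "X = {r}")
    case True
    have "?D X = \<lparr>pverts = {r}, parcs = {}\<rparr>"
      using True by auto
    then show ?thesis
      by (simp only: in_class.K1)
  next
    case not_single: False
    show ?thesis
    proof (cases "U = X")
      case True
      have "in_class (?D (X - {r}))"
        using r(1) not_single by (intro IH) auto
      then have "in_class (add_source r (?D (X - {r})))"
        by (rule in_class.source) simp
      also have "add_source r (?D (X - {r})) = ?D X"
        unfolding add_source_def using r(1) min True by (auto simp: U_def)
      finally show ?thesis .
    next
      case False
      have "in_class (?D U)" "in_class (?D (X - U))"
        by (rule IH; use r(1) False in \<open>auto simp: U_def\<close>)+
      then have "in_class (dunion (?D U) (?D (X - U)))"
        by (rule in_class.union) auto
      also have "dunion (?D U) (?D (X - U)) = ?D X"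
      proof -
        \<comment> \<open>No arc leaves or enters \<open>U\<close>. Forwards this is transitivity.
          Backwards, \<open>u\<close> and \<open>r\<close> both lie below \<open>v\<close>, hence
          are comparable, and minimality of \<open>r\<close> leaves only \<open>u = r\<close> or
          \<open>R r u\<close>.\<close>
        have "u \<in> U \<longleftrightarrow> v \<in> U" if "u \<in> X" "v \<in> X" "R u v" for u v
          using that r(1) min forest[of u r v] trans[of r u v] unfolding U_def by blast
        then have "{(u, v). u \<in> U \<and> v \<in> U \<and> u \<noteq> v \<and> R u v} \<union>
            {(u, v). u \<in> X - U \<and> v \<in> X - U \<and> u \<noteq> v \<and> R u v} =
            {(u, v). u \<in> X \<and> v \<in> X \<and> u \<noteq> v \<and> R u v}"
          unfolding U_def by blast
        then show ?thesis
          unfolding dunion_def by (auto simp: U_def)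
      qed
      finally show ?thesis .
    qed
  qed
qed

section \<open>The tree of an extremal family\<close>

text \<open>The part of the graph reached from the empty set by upward edges alone;
  \<open>ascending_eq\<close> shows that nothing else remains in the tree.\<close>

inductive_set ascending :: "'a set set \<Rightarrow> 'a set set" for F where
  empty: "{} \<in> ascending F"
| step: "C \<in> ascending F \<Longrightarrow> cube_edge F x C \<Longrightarrow> insert x C \<in> ascending F"

text \<open>\<open>F\<close> stands for the given collection with the empty set adjoined, hence the
  \<open>Suc\<close>. This is the smallest size that \<open>card_labels_less\<close> permits, and
  the arguments below exploit that tightness.\<close>

locale extremal_family =
  fixes F :: "'a set set" and X :: "'a set"
  assumes finite_X: "finite X"
    and subsets: "F \<subseteq> Pow X"
    and empty_mem: "{} \<in> F"
    and card_F: "card F = Suc (card X)"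
    and ex_edge: "x \<in> X \<Longrightarrow> \<exists>C. cube_edge F x C"
begin

lemma finite_F: "finite F"
  using subsets finite_X by (meson finite_Pow_iff finite_subset)

text \<open>Two \<open>x\<close>-edges would make the deletion of \<open>x\<close> merge two pairs,
  leaving at most \<open>card X - 1\<close> members to carry the remaining \<open>card X - 1\<close>
  labels.\<close>

lemma edge_unique:
  assumes "cube_edge F x C" "cube_edge F x C'"
  shows "C = C'"
proof (rule ccontr)
  assume "C \<noteq> C'"
  let ?del = "\<lambda>C. C - {x}"
  let ?I = "{insert x C, insert x C'}"
  have x: "x \<in> X"
    using assms(1) subsets unfolding cube_edge_def by auto
  have ne: "insert x C \<noteq> insert x C'"
    using assms \<open>C \<noteq> C'\<close> unfolding cube_edge_def by (metis Diff_insert_absorb)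
  have "\<exists>D. cube_edge (?del ` F) y D" if "y \<in> X - {x}" for y
    using that ex_edge[of y] cube_edge_contract[of F y _ x] by blast
  then have "card (X - {x}) < card (?del ` F)"
    using finite_X finite_F empty_mem by (intro card_labels_less) auto
  \<comment> \<open>Each upper end has the same image as its lower end, and the lower ends avoid
    \<open>?I\<close> because they lack \<open>x\<close>.\<close>
  also have "?del ` F \<subseteq> ?del ` (F - ?I)"
  proof -
    have "C \<in> F - ?I" "C' \<in> F - ?I"
      using assms unfolding cube_edge_def by auto
    moreover have "?del (insert x C) = ?del C" "?del (insert x C') = ?del C'"
      by auto
    ultimately have "?del D \<in> ?del ` (F - ?I)" if "D \<in> F" for D
      using that by (cases "D \<in> ?I") (auto simp del: insert_Diff_single)
    then show ?thesis
      by (rule image_subsetI)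
  qed
  then have "card (?del ` F) \<le> card (F - ?I)"
    using finite_F by (meson card_image_le card_mono finite_Diff finite_imageI le_trans)
  also have "card (F - ?I) = card F - 2"
    using assms ne unfolding cube_edge_def by (subst card_Diff_subset) auto
  finally show False
    using x finite_X card_F by simp
qed

text \<open>
  In the tree rooted at the empty set, the edge labelled \<open>x\<close> leads from \<open>parent x\<close> up to \<open>node x\<close>,
  and \<open>y \<in> node x\<close> means that \<open>y\<close> is an ancestor of \<open>x\<close> or \<open>x\<close> itself.
\<close>

definition parent :: "'a \<Rightarrow> 'a set" where
  "parent x = (SOME C. cube_edge F x C)"

definition node :: "'a \<Rightarrow> 'a set" where
  "node x = insert x (parent x)"

lemma cube_edge_parent: "x \<in> X \<Longrightarrow> cube_edge F x (parent x)"
  unfolding parent_def using ex_edge by (rule someI_ex)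

lemma parent_eqI: "cube_edge F x C \<Longrightarrow> parent x = C"
  unfolding parent_def by (rule some_equality) (simp_all add: edge_unique)

lemma self_mem_node: "x \<in> node x"
  by (simp add: node_def)

lemma cube_edge_label: "cube_edge F x C \<Longrightarrow> x \<in> X"
  using subsets unfolding cube_edge_def by auto

lemma ascending_subset: "ascending F \<subseteq> F"
proof
  fix M assume "M \<in> ascending F"
  then show "M \<in> F"
    by induction (auto simp: empty_mem cube_edge_def)
qed

text \<open>When a step adds \<open>x\<close> to \<open>C\<close>, uniqueness of edges gives
  \<open>C = parent x\<close>, so \<open>node x\<close> is the whole new member. It therefore
  contains all earlier labels, which makes \<open>x\<close> comparable with each of them.\<close>

lemma ascending_props:
  assumes "M \<in> ascending F"
  shows "\<forall>y\<in>M. parent y \<in> ascending F \<and> node y \<subseteq> M \<and> (\<forall>z\<in>M. y \<in> node z \<or> z \<in> node y)"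
  using assms
proof induction
  case (step C x)
  have [simp]: "parent x = C" "node x = insert x C"
    using parent_eqI[OF step.hyps(2)] by (simp_all add: node_def)
  show ?case
    using step by auto
qed simp

text \<open>If some member were not reached, every edge would lie either among the reached members
  or among the others. Counting labels on both sides separately would then require
  \<open>card X + 2\<close> members.\<close>

lemma ascending_eq: "ascending F = F"
proof (rule ccontr)
  assume "ascending F \<noteq> F"
  let ?S = "ascending F"
  let ?T = "F - ?S"
  \<comment> \<open>Upwards this is a step of the induction; downwards, \<open>x\<close> belongs to
    the upper end, so its parent \<open>C\<close> is ascending as well.\<close>
  have closed: "C \<in> ?S \<longleftrightarrow> insert x C \<in> ?S" if "cube_edge F x C" for x C
    using that ascending.step[of C F x] ascending_props[of "insert x C"] parent_eqI[OF that] by auto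
  let ?L = "{x \<in> X. parent x \<in> ?S}"
  have "card ?L < card ?S"
  proof (rule card_labels_less)
    show "?S \<noteq> {}"
      using ascending.empty by blast
    show "\<exists>C. cube_edge ?S x C" if "x \<in> ?L" for x
      using that closed[of x "parent x"] cube_edge_parent[of x] unfolding cube_edge_def by blast
  qed (use finite_X finite_F ascending_subset in \<open>auto intro: finite_subset\<close>)
  moreover have "card (X - ?L) < card ?T"
  proof (rule card_labels_less)
    show "?T \<noteq> {}"
      using \<open>?S \<noteq> F\<close> ascending_subset by blast
    show "\<exists>C. cube_edge ?T x C" if "x \<in> X - ?L" for x
      using that closed[of x "parent x"] cube_edge_parent[of x] unfolding cube_edge_def by blast
  qed (use finite_X finite_F in auto)
  moreover have "card ?T = card F - card ?S" "card ?S \<le> card F"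
    using ascending_subset finite_F by (auto intro: card_Diff_subset card_mono finite_subset)
  moreover have "card (X - ?L) = card X - card ?L"
    using finite_X by (intro card_Diff_subset) auto
  ultimately show False
    using card_F by linarith
qed

text \<open>A nonempty member is reached by a last step; the label of that step is the
  \<open>x\<close> whose node it is.\<close>

lemma node_image: "node ` X = F - {{}}"
proof
  show "node ` X \<subseteq> F - {{}}"
    using cube_edge_parent unfolding cube_edge_def node_def by auto
  show "F - {{}} \<subseteq> node ` X"
  proof
    fix M assume "M \<in> F - {{}}"
    then have "M \<in> ascending F" "M \<noteq> {}"
      by (simp_all add: ascending_eq)
    then show "M \<in> node ` X"
      by cases (auto simp: node_def parent_eqI cube_edge_label)
  qed
qed

lemma inj_node: "inj_on node X"
proof (rule eq_card_imp_inj_on)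
  show "card (node ` X) = card X"
    using finite_F empty_mem card_F by (simp add: node_image)
qed (rule finite_X)

text \<open>Read as statements on ancestors, these are transitivity and comparability of the
  ancestors of \<open>x\<close>, the forest conditions that \<open>in_class_forest\<close> asks
  for.\<close>

lemma node_props:
  assumes "x \<in> X" "y \<in> node x"
  shows "node y \<subseteq> node x" "z \<in> node x \<Longrightarrow> y \<in> node z \<or> z \<in> node y"
proof -
  have "node x \<in> ascending F"
    using assms(1) node_image ascending_eq by blast
  from ascending_props[OF this] assms(2)
  show "node y \<subseteq> node x" "z \<in> node x \<Longrightarrow> y \<in> node z \<or> z \<in> node y"
    by blast+
qed

lemma node_antisym:
  assumes "x \<in> X" "y \<in> X" "x \<in> node y" "y \<in> node x"
  shows "x = y"
  using node_props(1)[OF assms(1,4)] node_props(1)[OF assms(2,3)]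
  by (intro inj_onD[OF inj_node _ assms(1,2)] subset_antisym)

text \<open>\<open>f\<close> only carries labels over to the vertex type. Arcs run from ancestors to
  descendants, so the closed in-neighbourhood of \<open>f x\<close> pulls back to
  \<open>node x\<close>.\<close>

lemma in_class_node:
  fixes f :: "'a \<Rightarrow> 'v"
  assumes "X \<noteq> {}" "inj_on f X"
  obtains D where "in_class D" "bij_betw f X (pverts D)"
    "F - {{}} = {f -` closed_in_nbhd D v \<inter> X | v. v \<in> pverts D}"
proof
  let ?g = "the_inv_into X f"
  let ?D = "\<lparr>pverts = f ` X,
    parcs = {(u, v). u \<in> f ` X \<and> v \<in> f ` X \<and> u \<noteq> v \<and> ?g u \<in> node (?g v)}\<rparr>"
  have g: "?g (f x) = x" if "x \<in> X" for x
    using assms(2) that by (rule the_inv_into_f_f)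
  show "in_class ?D"
  proof (rule in_class_forest)
    show "u = v" if "u \<in> f ` X" "v \<in> f ` X" "?g u \<in> node (?g v)" "?g v \<in> node (?g u)" for u v
      using that node_antisym[of "?g u" "?g v"] by (auto simp: g)
    show "?g u \<in> node (?g w)"
      if "u \<in> f ` X" "v \<in> f ` X" "w \<in> f ` X" "?g u \<in> node (?g v)" "?g v \<in> node (?g w)" for u v w
      using that node_props(1)[of "?g w" "?g v"] by (auto simp: g)
    show "?g u \<in> node (?g v) \<or> ?g v \<in> node (?g u)"
      if "u \<in> f ` X" "v \<in> f ` X" "w \<in> f ` X" "?g u \<in> node (?g w)" "?g v \<in> node (?g w)" for u v w
      using that node_props(2)[of "?g w" "?g u" "?g v"] by (auto simp: g)
  qed (use assms finite_X in auto)
  show "bij_betw f X (pverts ?D)"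
    using assms(2) by (simp add: bij_betw_def)
  have "f -` closed_in_nbhd ?D (f x) \<inter> X = node x" if "x \<in> X" for x
  proof -
    have "node x \<subseteq> X"
      using that node_image subsets by auto
    then show ?thesis
      using that self_mem_node inj_on_eq_iff[OF assms(2)] by (auto simp: closed_in_nbhd_def g)
  qed
  then have "{f -` closed_in_nbhd ?D v \<inter> X | v. v \<in> f ` X} = node ` X"
    by (auto simp: image_iff)
  then show "F - {{}} = {f -` closed_in_nbhd ?D v \<inter> X | v. v \<in> pverts ?D}"
    by (simp add: node_image)
qed

end

section \<open>Extremality as the existence of an edge for every label\<close>

text \<open>The first alternative of extremality yields \<open>A = {x}\<close>, an edge from the
  adjoined empty set; in the second, one of the two sets is the other with \<open>x\<close>
  added.\<close>

lemma extremal_family_insert_empty: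
  assumes "finite X" "\<A> \<subseteq> Pow X" "card \<A> = card X" "extremal \<A> X"
  shows "extremal_family (insert {} \<A>) X"
proof
  have "finite \<A>"
    using assms by (meson finite_Pow_iff finite_subset)
  then show "card (insert {} \<A>) = Suc (card X)"
    using assms by (simp add: extremal_def)
  show "\<exists>C. cube_edge (insert {} \<A>) x C" if "x \<in> X" for x
  proof -
    have "{} \<notin> \<A>" and "(\<exists>A\<in>\<A>. A - {x} = {}) \<or>
        (\<exists>A\<in>\<A>. \<exists>A'\<in>\<A>. A \<noteq> A' \<and> A - {x} = A' - {x})"
      using assms(4) that unfolding extremal_def by simp_all
    from this(2) show ?thesis
    proof (elim disjE bexE conjE)
      fix A assume A: "A \<in> \<A>" "A - {x} = {}"
      then have "A \<noteq> {}"
        using \<open>{} \<notin> \<A>\<close> by blast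
      then have "A = {x}"
        using A(2) by blast
      then show ?thesis
        using A(1) by (intro exI[of _ "{}"]) (simp add: cube_edge_def)
    next
      fix A A' assume A: "A \<in> \<A>" "A' \<in> \<A>" "A \<noteq> A'" "A - {x} = A' - {x}"
      then have "(x \<notin> A \<and> A' = insert x A) \<or> (x \<notin> A' \<and> A = insert x A')"
        by (metis Diff_empty Diff_insert0 insert_Diff)
      then show ?thesis
        using A(1,2) unfolding cube_edge_def by auto
    qed
  qed
qed (use assms in auto)

section \<open>Digraphs of the class give extremal families\<close>

lemma closed_in_nbhd_dunion:
  assumes "in_class D2" "u \<notin> pverts D2"
  shows "closed_in_nbhd (dunion D1 D2) u = closed_in_nbhd D1 u"
proof -
  interpret pair_digraph D2
    using assms(1) by (rule in_class_pair_digraph)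
  show ?thesis
    using assms(2) in_arcsD2 by (auto simp: closed_in_nbhd_def dunion_def)
qed

lemma dunion_commute: "dunion D1 D2 = dunion D2 D1"
  by (simp add: dunion_def Un_commute)

lemma closed_in_nbhd_add_source:
  assumes "in_class D" "x \<notin> pverts D"
  shows "closed_in_nbhd (add_source x D) x = {x}"
    and "u \<in> pverts D \<Longrightarrow> closed_in_nbhd (add_source x D) u = insert x (closed_in_nbhd D u)"
proof -
  interpret pair_digraph D
    using assms(1) by (rule in_class_pair_digraph)
  show "closed_in_nbhd (add_source x D) x = {x}"
    using assms(2) in_arcsD2 by (auto simp: closed_in_nbhd_def add_source_def)
  show "u \<in> pverts D \<Longrightarrow> closed_in_nbhd (add_source x D) u = insert x (closed_in_nbhd D u)"
    by (auto simp: closed_in_nbhd_def add_source_def)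
qed

text \<open>In forest terms \<open>u\<close> is a root or has a parent \<open>v\<close>. Disjoint
  unions preserve this; a new source becomes a root and the parent of all former roots.\<close>

lemma closed_in_nbhd_cases:
  assumes "in_class D" "u \<in> pverts D"
  obtains "closed_in_nbhd D u = {u}"
  | v where "v \<in> pverts D" "u \<notin> closed_in_nbhd D v"
      "closed_in_nbhd D u = insert u (closed_in_nbhd D v)"
proof -
  let ?P = "\<lambda>D u. closed_in_nbhd D u = {u} \<or>
    (\<exists>v\<in>pverts D. u \<notin> closed_in_nbhd D v \<and> closed_in_nbhd D u = insert u (closed_in_nbhd D v))"
  have "?P D u"
    using assms
  proof (induction arbitrary: u)
    case (K1 v)
    then show ?case by (simp add: closed_in_nbhd_def)
  next
    case (union D1 D2)
    \<comment> \<open>Stated for arbitrary summands, so that commutativity of the union also covers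
      vertices of the second one.\<close>
    have left: "?P (dunion D1 D2) u"
      if "in_class D2" "pverts D1 \<inter> pverts D2 = {}" "u \<in> pverts D1" "?P D1 u" for D1 D2 u
    proof -
      have eq: "closed_in_nbhd (dunion D1 D2) w = closed_in_nbhd D1 w" if "w \<in> pverts D1" for w
        using that \<open>in_class D2\<close> \<open>pverts D1 \<inter> pverts D2 = {}\<close>
        by (intro closed_in_nbhd_dunion) auto
      from that(4) show ?thesis
      proof (elim disjE bexE conjE)
        assume "closed_in_nbhd D1 u = {u}"
        then show ?thesis
          using eq[OF that(3)] by simp
      next
        fix v assume "v \<in> pverts D1" "u \<notin> closed_in_nbhd D1 v"
          "closed_in_nbhd D1 u = insert u (closed_in_nbhd D1 v)"
        then have "v \<in> pverts (dunion D1 D2)" "u \<notin> closed_in_nbhd (dunion D1 D2) v"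
          "closed_in_nbhd (dunion D1 D2) u = insert u (closed_in_nbhd (dunion D1 D2) v)"
          using eq[of u] eq[of v] that(3) by (simp_all add: dunion_def)
        then show ?thesis
          by blast
      qed
    qed
    show ?case
    proof (cases "u \<in> pverts D1")
      case True
      then show ?thesis
        using union.hyps union.IH(1) by (intro left)
    next
      case False
      then have u: "u \<in> pverts D2"
        using union.prems by (simp add: dunion_def)
      have "pverts D2 \<inter> pverts D1 = {}"
        using union.hyps by blast
      then have "?P (dunion D2 D1) u"
        using union.hyps(1) u union.IH(2)[OF u] by (intro left)
      then show ?thesis
        by (simp only: dunion_commute)
    qed
  next
    case (source D x)
    note nbhd = closed_in_nbhd_add_source[OF source.hyps]
    have verts: "pverts (add_source x D) = insert x (pverts D)"
      by (simp add: add_source_def)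
    show ?case
    proof (cases "u = x")
      case True
      then show ?thesis
        using nbhd(1) by simp
    next
      case False
      then have u: "u \<in> pverts D"
        using source.prems verts by simp
      from source.IH[OF u] show ?thesis
      proof
        assume "closed_in_nbhd D u = {u}"
        then have "closed_in_nbhd (add_source x D) u =
            insert u (closed_in_nbhd (add_source x D) x)"
          using nbhd(1) nbhd(2)[OF u] by auto
        then show ?thesis
          using False verts nbhd(1) by auto
      next
        assume "\<exists>v\<in>pverts D. u \<notin> closed_in_nbhd D v \<and>
          closed_in_nbhd D u = insert u (closed_in_nbhd D v)"
        then obtain v where "v \<in> pverts D" "u \<notin> closed_in_nbhd D v"
          "closed_in_nbhd D u = insert u (closed_in_nbhd D v)"
          by blast
        then have "v \<in> pverts (add_source x D)" "u \<notin> closed_in_nbhd (add_source x D) v"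
          "closed_in_nbhd (add_source x D) u = insert u (closed_in_nbhd (add_source x D) v)"
          using False u verts nbhd(2) by auto
        then show ?thesis
          by blast
      qed
    qed
  qed
  then show thesis
    using that by blast
qed

text \<open>For a root \<open>f x\<close> the set is \<open>{x}\<close>; otherwise the sets of
  \<open>f x\<close> and of its parent differ exactly by \<open>x\<close>.\<close>

lemma nbhd_family_extremal:
  assumes "in_class D" "bij_betw f X (pverts D)"
  shows "extremal {f -` closed_in_nbhd D v \<inter> X | v. v \<in> pverts D} X" (is "extremal ?\<A> X")
  unfolding extremal_def
proof (intro conjI ballI)
  have inj: "inj_on f X" and img: "f ` X = pverts D"
    using assms(2) by (auto simp: bij_betw_def)
  have "f -` closed_in_nbhd D v \<inter> X \<noteq> {}" if "v \<in> pverts D" for v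
    using that by (auto simp: closed_in_nbhd_def simp flip: img)
  then show "{} \<notin> ?\<A>"
    by auto
  fix x assume x: "x \<in> X"
  then have fx: "f x \<in> pverts D"
    using img by blast
  with assms(1) show "(\<exists>A\<in>?\<A>. A - {x} = {}) \<or>
      (\<exists>A\<in>?\<A>. \<exists>A'\<in>?\<A>. A \<noteq> A' \<and> A - {x} = A' - {x})"
  proof (cases rule: closed_in_nbhd_cases)
    case 1
    then have "f -` closed_in_nbhd D (f x) \<inter> X - {x} = {}"
      using x inj_on_eq_iff[OF inj] by auto
    then show ?thesis
      using fx by blast
  next
    case (2 v)
    let ?A = "f -` closed_in_nbhd D (f x) \<inter> X" and ?A' = "f -` closed_in_nbhd D v \<inter> X"
    have "?A = insert x ?A'" "x \<notin> ?A'"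
      using 2 x inj_on_eq_iff[OF inj] by auto
    then have "?A \<noteq> ?A' \<and> ?A - {x} = ?A' - {x}"
      by blast
    moreover have "?A \<in> ?\<A>" "?A' \<in> ?\<A>"
      using fx 2(1) by blast+
    ultimately show ?thesis
      by (intro disjI2 bexI)
  qed
qed

section \<open>Isomorphisms of the bipartite graphs\<close>

text \<open>The equation for \<open>app_iso\<close> forces the arc map to act as the vertex map on
  both ends; injectivity on vertices then reflects arcs.\<close>

lemma part_isomorphism_arc_iff:
  assumes h: "part_isomorphism G H h" and "wf_digraph (with_proj G)"
    and a: "a \<in> pverts G" and b: "b \<in> pverts G"
  shows "(iso_verts h a, iso_verts h b) \<in> parcs H \<longleftrightarrow> (a, b) \<in> parcs G"
proof -
  interpret wf_digraph "with_proj G" by fact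
  have iso: "digraph_isomorphism h" and app: "app_iso h (with_proj G) = with_proj H"
    using h by (auto simp: part_isomorphism_def)
  have tail: "iso_tail h = fst" and head: "iso_head h = snd"
    using arg_cong[OF app, of tail] arg_cong[OF app, of head] by simp_all
  have arcs: "parcs H = iso_arcs h ` parcs G"
    using arg_cong[OF app, of arcs] by simp
  have arc: "iso_arcs h (c, d) = (iso_verts h c, iso_verts h d)" if "(c, d) \<in> parcs G" for c d
    using that iso_verts_tail[OF iso, of "(c, d)"] iso_verts_head[OF iso, of "(c, d)"] tail head
    by (simp add: prod_eq_iff)
  show ?thesis
  proof
    assume ab: "(a, b) \<in> parcs G"
    then have "iso_arcs h (a, b) \<in> parcs H"
      unfolding arcs by (rule imageI)
    then show "(iso_verts h a, iso_verts h b) \<in> parcs H"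
      using arc[OF ab] by simp
  next
    assume "(iso_verts h a, iso_verts h b) \<in> parcs H"
    then obtain c d where cd: "(c, d) \<in> parcs G"
      and "(iso_verts h a, iso_verts h b) = iso_arcs h (c, d)"
      unfolding arcs by (elim imageE) (metis surj_pair)
    then have "iso_verts h a = iso_verts h c" "iso_verts h b = iso_verts h d"
      using arc[OF cd] by simp_all
    moreover have "c \<in> pverts G" "d \<in> pverts G"
      using cd tail_in_verts[of "(c, d)"] head_in_verts[of "(c, d)"] by simp_all
    ultimately show "(a, b) \<in> parcs G"
      using iso_verts_eq_iff[OF iso] a b cd by simp
  qed
qed

lemma wf_bip_incidence: "wf_digraph (with_proj (bip_incidence \<A> X))"
  by unfold_locales (auto simp: bip_incidence_def)

lemma bip_parts:
  "pverts (bip_incidence \<A> X) \<inter> range Inl = Inl ` X"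
  "pverts (bip_incidence \<A> X) \<inter> range Inr = Inr ` \<A>"
  "pverts (bip_digraph D) \<inter> range Inl = Inl ` pverts D"
  "pverts (bip_digraph D) \<inter> range Inr = Inr ` pverts D"
  by (auto simp: bip_incidence_def bip_digraph_def)

text \<open>The restrictions of \<open>h\<close> to the two parts give \<open>f\<close> on
  \<open>X\<close> and \<open>g\<close> on \<open>\<A>\<close>. Preservation of adjacency says that
  \<open>x\<close> lies in \<open>A\<close> iff \<open>f x\<close> lies in the closed
  in-neighbourhood of \<open>g A\<close>.\<close>

lemma part_isomorphism_nbhd_family:
  assumes "\<A> \<subseteq> Pow X"
    and h: "part_isomorphism (bip_incidence \<A> X) (bip_digraph D) h"
  obtains f where "bij_betw f X (pverts D)" "\<A> = {f -` closed_in_nbhd D v \<inter> X | v. v \<in> pverts D}"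
proof
  let ?G = "bip_incidence \<A> X"
  \<comment> \<open>The projections are meaningful because \<open>h\<close> maps each part onto the
    part of the same side.\<close>
  define f where "f = projl \<circ> iso_verts h \<circ> Inl"
  define g where "g = projr \<circ> iso_verts h \<circ> Inr"
  have l: "iso_verts h ` Inl ` X = Inl ` pverts D"
    and r: "iso_verts h ` Inr ` \<A> = Inr ` pverts D"
    using h unfolding part_isomorphism_def bip_parts by blast+
  have fx: "iso_verts h (Inl x) = Inl (f x)" "f x \<in> pverts D" if "x \<in> X" for x
  proof -
    have "iso_verts h (Inl x) \<in> Inl ` pverts D"
      using that l by blast
    then show "iso_verts h (Inl x) = Inl (f x)" "f x \<in> pverts D"
      by (auto simp: f_def)
  qed
  have gA: "iso_verts h (Inr A) = Inr (g A)" "g A \<in> pverts D" if "A \<in> \<A>" for A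
  proof -
    have "iso_verts h (Inr A) \<in> Inr ` pverts D"
      using that r by blast
    then show "iso_verts h (Inr A) = Inr (g A)" "g A \<in> pverts D"
      by (auto simp: g_def)
  qed
  have "inj_on (iso_verts h) (pverts ?G)"
    using h pre_digraph.digraph_isomorphism_inj_on_verts[of "with_proj ?G" h]
    unfolding part_isomorphism_def by simp
  then have "inj_on f X"
    by (auto simp: inj_on_def bip_incidence_def) (metis InlI UnI1 fx(1) imageI sum.inject(1))
  moreover have "f ` X = pverts D"
    using arg_cong[OF l, of "image projl"] by (simp add: f_def image_comp o_def)
  ultimately show "bij_betw f X (pverts D)"
    by (simp add: bij_betw_def)
  have img_g: "g ` \<A> = pverts D"
    using arg_cong[OF r, of "image projr"] by (simp add: g_def image_comp o_def)
  have eq: "A = f -` closed_in_nbhd D (g A) \<inter> X" if A: "A \<in> \<A>" for A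
  proof -
    have "f x \<in> closed_in_nbhd D (g A) \<longleftrightarrow> x \<in> A" if "x \<in> X" for x
    proof -
      have "f x \<in> closed_in_nbhd D (g A) \<longleftrightarrow> (Inl (f x), Inr (g A)) \<in> parcs (bip_digraph D)"
        using fx(2)[OF that] gA(2)[OF A] by (auto simp: closed_in_nbhd_def bip_digraph_def)
      also have "\<dots> \<longleftrightarrow> (Inl x, Inr A) \<in> parcs ?G"
        unfolding fx(1)[OF that, symmetric] gA(1)[OF A, symmetric]
        by (rule part_isomorphism_arc_iff[OF h wf_bip_incidence])
          (use that A in \<open>auto simp: bip_incidence_def\<close>)
      also have "\<dots> \<longleftrightarrow> x \<in> A"
        using that A by (auto simp: bip_incidence_def)
      finally show ?thesis .
    qed
    then show ?thesis
      using assms(1) A by auto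
  qed
  have "(\<lambda>A. A) ` \<A> = (\<lambda>A. f -` closed_in_nbhd D (g A) \<inter> X) ` \<A>"
    by (rule image_cong[OF refl eq])
  then have "\<A> = (\<lambda>A. f -` closed_in_nbhd D (g A) \<inter> X) ` \<A>"
    by (simp only: image_ident)
  also have "\<dots> = (\<lambda>v. f -` closed_in_nbhd D v \<inter> X) ` pverts D"
    by (simp only: image_image flip: img_g)
  also have "\<dots> = {f -` closed_in_nbhd D v \<inter> X | v. v \<in> pverts D}"
    by (rule Setcompr_eq_image[symmetric])
  finally show "\<A> = {f -` closed_in_nbhd D v \<inter> X | v. v \<in> pverts D}" .
qed

lemma nbhd_family_part_isomorphism:
  assumes "finite X" "card \<A> = card X" and f: "bij_betw f X (pverts D)"
    and \<A>: "\<A> = {f -` closed_in_nbhd D v \<inter> X | v. v \<in> pverts D}"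
  obtains h where "part_isomorphism (bip_incidence \<A> X) (bip_digraph D) h"
proof
  let ?G = "bip_incidence \<A> X" and ?H = "bip_digraph D"
  let ?S = "\<lambda>v. f -` closed_in_nbhd D v \<inter> X"
  define g where "g = the_inv_into (pverts D) ?S"
  let ?\<phi> = "map_sum f g"
  let ?h = "\<lparr>iso_verts = ?\<phi>, iso_arcs = map_prod ?\<phi> ?\<phi>, iso_head = snd, iso_tail = fst\<rparr>"
  have inj_f: "inj_on f X" and img_f: "f ` X = pverts D"
    using f by (auto simp: bij_betw_def)
  have S_img: "?S ` pverts D = \<A>"
    unfolding \<A> by blast
  have "finite (pverts D)" "card (pverts D) = card X"
    using f assms(1) bij_betw_finite bij_betw_same_card by metis+
  \<comment> \<open>The equality of cardinalities enters here: distinct vertices have distinct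
    neighbourhood sets, so \<open>g\<close> can invert \<open>?S\<close>.\<close>
  then have S_inj: "inj_on ?S (pverts D)"
    using S_img assms(2) by (intro eq_card_imp_inj_on) simp_all
  then have g: "bij_betw g \<A> (pverts D)"
    unfolding g_def using S_inj S_img by (intro bij_betw_the_inv_into) (simp add: bij_betw_def)
  have gS: "g (?S v) = v" if "v \<in> pverts D" for v
    unfolding g_def using S_inj that by (rule the_inv_into_f_f)
  \<comment> \<open>Both arc sets consist of one relation and its converse, tagged by sides; it
    suffices to transport that relation.\<close>
  define E where "E = {(x, A). x \<in> X \<and> A \<in> \<A> \<and> x \<in> A}"
  define E' where "E' = {(u, v). u \<in> pverts D \<and> v \<in> pverts D \<and> ((u, v) \<in> parcs D \<or> u = v)}"
  have E: "map_prod f g ` E = E'"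
  proof (intro subset_antisym subsetI)
    fix e assume "e \<in> map_prod f g ` E"
    then obtain x A where e: "e = (f x, g A)" "x \<in> X" "A \<in> \<A>" "x \<in> A"
      unfolding E_def by auto
    then obtain v where v: "v \<in> pverts D" "A = ?S v"
      using S_img by blast
    then have "f x \<in> closed_in_nbhd D v" "f x \<in> pverts D"
      using e(2,4) img_f by auto
    then show "e \<in> E'"
      using e(1) gS[OF v(1)] v by (auto simp: E'_def closed_in_nbhd_def)
  next
    fix e assume "e \<in> E'"
    then obtain u v where e: "e = (u, v)" "u \<in> pverts D" "v \<in> pverts D"
        "u \<in> closed_in_nbhd D v"
      unfolding E'_def closed_in_nbhd_def by auto
    then obtain x where x: "x \<in> X" "u = f x"
      using img_f by blast
    have "(x, ?S v) \<in> E"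
      using e S_img x by (auto simp: E_def)
    then have "map_prod f g (x, ?S v) \<in> map_prod f g ` E"
      by (rule imageI)
    then show "e \<in> map_prod f g ` E"
      using e x gS[OF e(3)] by simp
  qed
  have "parcs ?G = (\<lambda>(x, A). (Inl x, Inr A)) ` E \<union> (\<lambda>(x, A). (Inr A, Inl x)) ` E"
    unfolding bip_incidence_def E_def by force
  moreover have "parcs ?H = (\<lambda>(u, v). (Inl u, Inr v)) ` E' \<union> (\<lambda>(u, v). (Inr v, Inl u)) ` E'"
    unfolding bip_digraph_def E'_def by force
  ultimately have arcs: "map_prod ?\<phi> ?\<phi> ` parcs ?G = parcs ?H"
    unfolding E[symmetric] by (simp add: image_Un image_image split_def)
  have "?\<phi> ` Inl ` X = Inl ` f ` X" "?\<phi> ` Inr ` \<A> = Inr ` g ` \<A>"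
    by (simp_all only: image_image map_sum.simps)
  then have verts: "?\<phi> ` Inl ` X = Inl ` pverts D" "?\<phi> ` Inr ` \<A> = Inr ` pverts D"
    using img_f g by (simp_all only: bij_betw_def)
  have inj: "inj_on ?\<phi> (pverts ?G)"
  proof (rule inj_onI)
    fix a b assume "a \<in> pverts ?G" "b \<in> pverts ?G" "?\<phi> a = ?\<phi> b"
    then show "a = b"
      by (cases a; cases b)
        (auto simp: bip_incidence_def inj_on_eq_iff[OF inj_f]
          inj_on_eq_iff[OF bij_betw_imp_inj_on[OF g]])
  qed
  interpret wf_digraph "with_proj ?G"
    by (rule wf_bip_incidence)
  have "parcs ?G \<subseteq> pverts ?G \<times> pverts ?G"
    by (auto simp: bip_incidence_def)
  then have "inj_on (map_prod ?\<phi> ?\<phi>) (parcs ?G)"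
    using map_prod_inj_on[OF inj inj] by (rule inj_on_subset[rotated])
  then have "digraph_isomorphism ?h"
    using inj wf_bip_incidence by (simp add: digraph_isomorphism_def)
  moreover have "?\<phi> ` pverts ?G = pverts ?H"
    using verts by (simp add: bip_incidence_def bip_digraph_def image_Un)
  then have "app_iso ?h (with_proj ?G) = with_proj ?H"
    by (simp add: app_iso_def with_proj_def arcs)
  ultimately show "part_isomorphism ?G ?H ?h"
    unfolding part_isomorphism_def bip_parts using verts by simp
qed

theorem theorem6:
  fixes X :: "'a set" and \<A> :: "'a set set"
  assumes "finite X" and "X \<noteq> {}"
    and "\<A> \<subseteq> Pow X"
    and "card \<A> = card X"
  shows "(extremal \<A> X \<longleftrightarrow>
            (\<exists>(D :: nat pair_pre_digraph) h.
               in_class D \<and> part_isomorphism (bip_incidence \<A> X) (bip_digraph D) h))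
       \<and> (extremal \<A> X \<longleftrightarrow>
            (\<exists>(D :: nat pair_pre_digraph) f.
               in_class D \<and> bij_betw f X (pverts D) \<and>
               \<A> = {f -` closed_in_nbhd D v \<inter> X | v. v \<in> pverts D}))"
  (is "(?E \<longleftrightarrow> ?H) \<and> (?E \<longleftrightarrow> ?N)")
proof -
  \<comment> \<open>Both equivalences pass through the neighbourhood form \<open>?N\<close>, shown
    equivalent to \<open>?E\<close> and to \<open>?H\<close>.\<close>
  have "?N" if ?E
  proof -
    interpret extremal_family "insert {} \<A>" X
      by (rule extremal_family_insert_empty[OF assms(1,3,4) that])
    \<comment> \<open>Finiteness of \<open>X\<close> lets natural numbers serve as vertices.
      Nonemptiness is used just below, since every digraph of the class has a vertex.\<close>
    obtain f :: "'a \<Rightarrow> nat" where "inj_on f X"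
      using finite_imp_inj_to_nat_seg[OF assms(1)] by blast
    then obtain D where "in_class D" "bij_betw f X (pverts D)"
      "insert {} \<A> - {{}} = {f -` closed_in_nbhd D v \<inter> X | v. v \<in> pverts D}"
      by (rule in_class_node[OF assms(2)])
    moreover have "insert {} \<A> - {{}} = \<A>"
      using that by (auto simp: extremal_def)
    ultimately show ?thesis
      by (intro exI[of _ D] exI[of _ f]) simp
  qed
  moreover have ?E if ?N
    using that by (elim exE conjE) (simp add: nbhd_family_extremal)
  moreover have ?H if ?N
    using that
  proof (elim exE conjE)
    fix D :: "nat pair_pre_digraph" and f
    assume D: "in_class D" and f: "bij_betw f X (pverts D)"
      "\<A> = {f -` closed_in_nbhd D v \<inter> X | v. v \<in> pverts D}"
    obtain h where "part_isomorphism (bip_incidence \<A> X) (bip_digraph D) h"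
      using f by (rule nbhd_family_part_isomorphism[OF assms(1,4)])
    with D show ?H
      by (intro exI conjI)
  qed
  moreover have ?N if ?H
    using that
  proof (elim exE conjE)
    fix D :: "nat pair_pre_digraph" and h
    assume D: "in_class D" and h: "part_isomorphism (bip_incidence \<A> X) (bip_digraph D) h"
    obtain f where "bij_betw f X (pverts D)"
      "\<A> = {f -` closed_in_nbhd D v \<inter> X | v. v \<in> pverts D}"
      using h by (rule part_isomorphism_nbhd_family[OF assms(3)])
    with D show ?N
      by (intro exI conjI)
  qed
  ultimately show ?thesis
    by argo
qed

end
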